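(* Let $n,k\ge 2$ with $k$ even, and let $\mathcal{T}=(t_{i_1\ldots i_k})$ be a zero diagonal symmetric real tensor of order $k$ and dimension $n$. Let $\mathbf{x}$ be a least eigenvector of $\mathcal{T}$. Let $\emptyset\ne I\subset[n]$ be a proper subset. Then $$\lambda_{\min}(\mathcal{T})\ \le\ \lambda_{\min}(\mathcal{T}[I])\ \le\ \lambda_{\min}(\mathcal{T})\Bigl(1-k\sum_{i\in [n]\setminus I}x_i^k\Bigr)-\sum_{j=1}^{k-1}(-1)^j\binom{k}{j+1}\sum_{\substack{i_1,\ldots,i_{j+1}\in [n]\setminus I\\ i_{j+2},\ldots,i_k\in[n]}}t_{i_1 \ldots i_k}x_{i_1}\cdots x_{i_k}.$$ Moreover, if $\sum_{i\in I}x_i^k\ne 0$, then $$\lambda_{\min}(\mathcal{T}[I])\ \le\ \frac{\lambda_{\min}(\mathcal{T})\Bigl(1-k\sum_{i\in [n]\setminus I} x_i^k\Bigr)-\sum_{j=1}^{k-1}(-1)^j\binom{k}{j+1}\sum_{\substack{i_1,\ldots,i_{j+1}\in [n]\setminus I\\ i_{j+2},\ldots, i_k\in [n]}}t_{i_1 \ldots i_k} x_{i_1}\cdots x_{i_k}}{\sum_{i\in I} x_i^k}.$$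
   Context: $[n]=\{1,\dots,n\}$. A real tensor $\mathcal{T}=(t_{i_1\ldots i_k})$ of order $k$ and dimension $n$ is an array of reals indexed by $(i_1,\dots,i_k)\in[n]^k$. It is symmetric if its entries are invariant under all permutations of the indices, and zero diagonal if $t_{i\ldots i}=0$ for all $i\in[n]$. A real number $\lambda$ is an H-eigenvalue of $\mathcal{T}$ with H-eigenvector $\mathbf{x}\in\mathbb{R}^n\setminus\{0\}$ if $\lambda x_i^{k-1}=\sum_{i_2,\dots,i_k\in[n]}t_{ii_2\dots i_k}x_{i_2}\cdots x_{i_k}$ for all $i\in[n]$. $\lambda_{\min}(\mathcal{T})$ is the least H-eigenvalue of $\mathcal{T}$ (H-eigenvalues exist for symmetric tensors of even order). A vector $\mathbf{x}\in\mathbb{R}^n$ is unit if $\sum_{i}|x_i|^k=1$. A least eigenvector of $\mathcal{T}$ is a unit (real) eigenvector associated with $\lambda_{\min}(\mathcal{T})$. For nonempty $I\subseteq[n]$, the principal subtensor $\mathcal{T}[I]$ is the tensor of order $k$ and dimension $|I|$ with entries $t_{i_1\ldots i_k}$, $i_1,\dots,i_k\in I$. *)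

theory Defs
  imports Complex_Main "HOL-Combinatorics.Permutations" "HOL-Library.FuncSet"
begin

text \<open>
  A real tensor of order \<open>k\<close> is a function \<open>t :: 'a list \<Rightarrow> real\<close> considered on \<open>multi_indices k J\<close>,
  with \<open>J\<close> a finite index set; a vector is a function considered on \<open>J\<close>.
  A tensor of dimension \<open>n\<close> has \<open>J = {1..n}\<close>.  Values at other arguments are irrelevant.
  Keeping \<open>J\<close> arbitrary lets a principal subtensor retain the indices of the original tensor,
  without renumbering \<open>I\<close> as \<open>{1..card I}\<close>.
\<close>

definition multi_indices :: "nat \<Rightarrow> 'a set \<Rightarrow> 'a list set" where
  "multi_indices k J = {ix. length ix = k \<and> set ix \<subseteq> J}"

definition symmetric_tensor :: "nat \<Rightarrow> 'a set \<Rightarrow> ('a list \<Rightarrow> real) \<Rightarrow> bool" where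
  "symmetric_tensor k J t \<longleftrightarrow>
     (\<forall>ix \<in> multi_indices k J. \<forall>p. p permutes {..<k} \<longrightarrow> t (permute_list p ix) = t ix)"

definition zero_diagonal :: "nat \<Rightarrow> 'a set \<Rightarrow> ('a list \<Rightarrow> real) \<Rightarrow> bool" where
  "zero_diagonal k J t \<longleftrightarrow> (\<forall>i \<in> J. t (replicate k i) = 0)"

definition H_eigenpair ::
  "nat \<Rightarrow> 'a set \<Rightarrow> ('a list \<Rightarrow> real) \<Rightarrow> real \<Rightarrow> ('a \<Rightarrow> real) \<Rightarrow> bool" where
  "H_eigenpair k J t l x \<longleftrightarrow>
     (\<exists>i \<in> J. x i \<noteq> 0) \<and>
     (\<forall>i \<in> J. l * x i ^ (k - 1) = (\<Sum>ix \<in> multi_indices (k - 1) J. t (i # ix) * prod_list (map x ix)))"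

definition H_eigenvalue :: "nat \<Rightarrow> 'a set \<Rightarrow> ('a list \<Rightarrow> real) \<Rightarrow> real \<Rightarrow> bool" where
  "H_eigenvalue k J t l \<longleftrightarrow> (\<exists>x. H_eigenpair k J t l x)"

text \<open>Unspecified if there is no least H-eigenvalue; for symmetric tensors of even order
  over a nonempty finite index set there always is one.\<close>

definition lambda_min :: "nat \<Rightarrow> 'a set \<Rightarrow> ('a list \<Rightarrow> real) \<Rightarrow> real" where
  "lambda_min k J t = (LEAST l. H_eigenvalue k J t l)"

definition unit_vector :: "nat \<Rightarrow> 'a set \<Rightarrow> ('a \<Rightarrow> real) \<Rightarrow> bool" where
  "unit_vector k J x \<longleftrightarrow> (\<Sum>i \<in> J. \<bar>x i\<bar> ^ k) = 1"

definition least_eigenvector ::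
  "nat \<Rightarrow> 'a set \<Rightarrow> ('a list \<Rightarrow> real) \<Rightarrow> ('a \<Rightarrow> real) \<Rightarrow> bool" where
  "least_eigenvector k J t x \<longleftrightarrow>
     unit_vector k J x \<and> H_eigenpair k J t (lambda_min k J t) x"

definition principal_subtensor ::
  "nat \<Rightarrow> ('a list \<Rightarrow> real) \<Rightarrow> 'a set \<Rightarrow> ('a list \<Rightarrow> real)" where
  "principal_subtensor k t I = restrict t (multi_indices k I)"

end

theory Submission
  imports Defs "HOL-Analysis.Function_Topology"
begin

text \<open>
  Write \<open>f\<^sub>J y\<close> for the homogeneous form \<open>\<Sum> t(i\<^sub>1,\<dots>,i\<^sub>k) y(i\<^sub>1) \<cdots> y(i\<^sub>k)\<close> over all indices in \<open>J\<close>.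

  For even \<open>k\<close> and a symmetric tensor the least H-eigenvalue is the minimum of \<open>f\<^sub>J\<close> on the sphere \<open>\<Sum> y(i)\<^sup>k = 1\<close>:
  Euler's identity makes every eigenvalue a value of \<open>f\<^sub>J\<close> on the sphere
  (\<open>tensor_form_eigenpair\<close>), and a minimizer, which exists by compactness, is an eigenvector by
  the first-order condition (\<open>form_minimizer_is_eigenvector\<close>).  Hence
  \<open>\<lambda> \<Sum> y(i)\<^sup>k \<le> f\<^sub>J y\<close> for all \<open>y\<close>, with \<open>\<lambda>\<close> the least eigenvalue (\<open>lambda_min_le_form\<close>).

  The first inequality follows by extending a least eigenvector of the subtensor by zero.
  For the upper bounds, the long expression \<open>B\<close> of the theorem is the value \<open>f\<^sub>I x\<close>, that is, the
  value of the whole form at the vector \<open>x\<close> with its entries outside \<open>I\<close> set to zero.  Removing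
  these entries means adding the vector that equals \<open>- x\<close> outside \<open>I\<close> and \<open>0\<close> on \<open>I\<close>; the
  binomial theorem for symmetric forms (\<open>symmetric_form_binomial\<close>) expands the result by the number
  of positions filled from outside \<open>I\<close>, and the terms with zero and one such position are
  evaluated with the eigenvalue equation.  Thus \<open>\<lambda>\<^sub>I \<Sum>\<^sub>I x(i)\<^sup>k \<le> B\<close>, which is the last claim after
  division.  A zero diagonal gives \<open>\<lambda>\<^sub>I \<le> 0\<close> by testing with a coordinate vector, and
  \<open>\<Sum>\<^sub>I x(i)\<^sup>k \<le> 1\<close>, so \<open>\<lambda>\<^sub>I \<le> B\<close> as well.

  The binomial theorem serves a second time: the coefficient of degree one along a coordinate
  direction is the partial derivative of the form.
\<close>

section \<open>Sums over multi-indices\<close>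

lemma multi_indices_0 [simp]: "multi_indices 0 J = {[]}"
  by (auto simp: multi_indices_def)

lemma multi_indices_Suc:
  "multi_indices (Suc m) J = (\<lambda>(i, ix). i # ix) ` (J \<times> multi_indices m J)"
  by (auto simp: multi_indices_def length_Suc_conv image_iff)

lemma finite_multi_indices [simp]: "finite J \<Longrightarrow> finite (multi_indices k J)"
  using finite_lists_length_eq[of J k] by (simp add: multi_indices_def conj_commute)

lemma multi_indices_mono: "I \<subseteq> J \<Longrightarrow> multi_indices k I \<subseteq> multi_indices k J"
  by (auto simp: multi_indices_def)

lemma sum_multi_indices_Suc:
  "(\<Sum>ix \<in> multi_indices (Suc m) J. F ix) = (\<Sum>i \<in> J. \<Sum>ix \<in> multi_indices m J. F (i # ix))"
proof -
  have "inj_on (\<lambda>(i, ix). i # ix) (J \<times> multi_indices m J)"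
    by (auto simp: inj_on_def)
  then show ?thesis
    by (simp add: multi_indices_Suc sum.reindex sum.cartesian_product case_prod_unfold)
qed

lemma prod_list_eq_0_outside:
  fixes y :: "'a \<Rightarrow> real"
  assumes "\<And>i. i \<in> J - I \<Longrightarrow> y i = 0" and "ix \<in> multi_indices k J - multi_indices k I"
  shows "prod_list (map y ix) = 0"
  using assms by (fastforce simp: multi_indices_def prod_list_zero_iff)

text \<open>
  This evaluates the form at a coordinate vector, and in the partial derivative it identifies the
  linear coefficient.
\<close>

lemma sum_multi_indices_unit_vector:
  assumes "finite J" "i \<in> J"
  shows "(\<Sum>ix \<in> multi_indices k J. F ix * prod_list (map (\<lambda>j. of_bool (j = i)) ix))
         = (F (replicate k i) :: real)"
proof (induction k arbitrary: F)
  case (Suc k)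
  have "(\<Sum>ix \<in> multi_indices (Suc k) J. F ix * prod_list (map (\<lambda>j. of_bool (j = i)) ix))
      = (\<Sum>h \<in> J. of_bool (h = i) *
          (\<Sum>ix \<in> multi_indices k J. F (h # ix) * prod_list (map (\<lambda>j. of_bool (j = i)) ix)))"
    by (simp add: sum_multi_indices_Suc sum_distrib_left mult_ac)
  also have "\<dots> = (\<Sum>h \<in> J. if h = i then F (h # replicate k h) else 0)"
    by (intro sum.cong refl) (simp add: Suc.IH)
  finally show ?case
    using assms by simp
qed simp

section \<open>Symmetric forms\<close>

definition tensor_form :: "nat \<Rightarrow> 'a set \<Rightarrow> ('a list \<Rightarrow> real) \<Rightarrow> ('a \<Rightarrow> real) \<Rightarrow> real" where
  "tensor_form k J t y = (\<Sum>ix \<in> multi_indices k J. t ix * prod_list (map y ix))"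

text \<open>The polarized form with \<open>y\<close> in the first \<open>j\<close> arguments and \<open>z\<close> in the other \<open>l\<close>.\<close>

definition mixed_form ::
  "nat \<Rightarrow> nat \<Rightarrow> 'a set \<Rightarrow> ('a list \<Rightarrow> real) \<Rightarrow> ('a \<Rightarrow> real) \<Rightarrow> ('a \<Rightarrow> real) \<Rightarrow> real" where
  "mixed_form j l J t y z =
     (\<Sum>u \<in> multi_indices j J. \<Sum>v \<in> multi_indices l J.
        t (u @ v) * (prod_list (map y u) * prod_list (map z v)))"

lemma tensor_form_cong:
  assumes "\<And>i. i \<in> J \<Longrightarrow> y i = z i"
  shows "tensor_form k J t y = tensor_form k J t z"
  unfolding tensor_form_def
proof (intro sum.cong refl)
  fix ix assume "ix \<in> multi_indices k J"
  then have "map y ix = map z ix"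
    using assms by (auto simp: multi_indices_def)
  then show "t ix * prod_list (map y ix) = t ix * prod_list (map z ix)"
    by (simp only:)
qed

lemma tensor_form_Suc:
  "tensor_form (Suc m) J t y = (\<Sum>i \<in> J. y i * tensor_form m J (\<lambda>ix. t (i # ix)) y)"
  by (simp add: tensor_form_def sum_multi_indices_Suc sum_distrib_left mult_ac)

lemma tensor_form_restrict_support:
  assumes "finite J" "I \<subseteq> J"
  shows "tensor_form k J t (\<lambda>i. if i \<in> I then y i else 0) = tensor_form k I t y"
proof -
  have "tensor_form k J t (\<lambda>i. if i \<in> I then y i else 0)
      = tensor_form k I t (\<lambda>i. if i \<in> I then y i else 0)"
    unfolding tensor_form_def
  proof (intro sum.mono_neutral_right ballI)
    fix ix assume "ix \<in> multi_indices k J - multi_indices k I"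
    then have "prod_list (map (\<lambda>i. if i \<in> I then y i else 0) ix) = 0"
      by (intro prod_list_eq_0_outside) auto
    then show "t ix * prod_list (map (\<lambda>i. if i \<in> I then y i else 0) ix) = 0"
      by simp
  qed (use assms in \<open>auto simp: multi_indices_mono\<close>)
  also have "\<dots> = tensor_form k I t y"
    by (rule tensor_form_cong) simp
  finally show ?thesis .
qed

lemma prod_list_scale:
  "prod_list (map (\<lambda>i. c * y i) ix) = (c :: real) ^ length ix * prod_list (map y ix)"
  by (induction ix) (auto simp: mult_ac)

lemma tensor_form_scale: "tensor_form k J t (\<lambda>i. c * y i) = c ^ k * tensor_form k J t y"
  unfolding tensor_form_def sum_distrib_left
  by (intro sum.cong refl) (auto simp: multi_indices_def prod_list_scale mult_ac)

lemma mixed_form_scale_left: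
  "mixed_form j l J t (\<lambda>i. c * y i) z = c ^ j * mixed_form j l J t y z"
  unfolding mixed_form_def sum_distrib_left
  by (intro sum.cong refl) (auto simp: multi_indices_def prod_list_scale mult_ac)

lemma symmetric_tensor_iff_mset:
  "symmetric_tensor k J t \<longleftrightarrow>
     (\<forall>ix \<in> multi_indices k J. \<forall>iy. mset iy = mset ix \<longrightarrow> t iy = t ix)"
proof
  assume sym: "symmetric_tensor k J t"
  show "\<forall>ix \<in> multi_indices k J. \<forall>iy. mset iy = mset ix \<longrightarrow> t iy = t ix"
  proof (intro ballI allI impI)
    fix ix iy assume ix: "ix \<in> multi_indices k J" and "mset iy = mset ix"
    then obtain p where "p permutes {..<length ix}" "permute_list p ix = iy"
      by (metis mset_eq_permutation)
    with sym ix show "t iy = t ix"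
      by (auto simp: symmetric_tensor_def multi_indices_def)
  qed
next
  assume inv: "\<forall>ix \<in> multi_indices k J. \<forall>iy. mset iy = mset ix \<longrightarrow> t iy = t ix"
  show "symmetric_tensor k J t"
    unfolding symmetric_tensor_def
  proof (intro ballI allI impI)
    fix ix p assume ix: "ix \<in> multi_indices k J" and "p permutes {..<k}"
    then have "mset (permute_list p ix) = mset ix"
      by (intro mset_permute_list) (simp add: multi_indices_def)
    with inv ix show "t (permute_list p ix) = t ix"
      by blast
  qed
qed

lemma symmetric_tensor_subset:
  "symmetric_tensor k J t \<Longrightarrow> I \<subseteq> J \<Longrightarrow> symmetric_tensor k I t"
  using multi_indices_mono[of I J k] unfolding symmetric_tensor_def by blast

lemma symmetric_tensor_Cons:
  assumes "symmetric_tensor (Suc m) J t" "i \<in> J"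
  shows "symmetric_tensor m J (\<lambda>ix. t (i # ix))"
proof -
  have "t (i # iy) = t (i # ix)" if "ix \<in> multi_indices m J" "mset iy = mset ix" for ix iy
  proof -
    have "i # ix \<in> multi_indices (Suc m) J"
      using that assms(2) by (auto simp: multi_indices_def)
    moreover have "mset (i # iy) = mset (i # ix)"
      using that by simp
    ultimately show ?thesis
      using assms(1) unfolding symmetric_tensor_iff_mset by blast
  qed
  then show ?thesis
    unfolding symmetric_tensor_iff_mset by blast
qed

lemma mixed_form_Suc_left:
  "mixed_form (Suc j) l J t y z = (\<Sum>i \<in> J. y i * mixed_form j l J (\<lambda>ix. t (i # ix)) y z)"
  by (simp add: mixed_form_def sum_multi_indices_Suc sum_distrib_left mult_ac)

lemma mixed_form_Suc_right:
  assumes "symmetric_tensor (Suc (j + l)) J t"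
  shows "mixed_form j (Suc l) J t y z = (\<Sum>i \<in> J. z i * mixed_form j l J (\<lambda>ix. t (i # ix)) y z)"
proof -
  have move: "t (u @ i # v) = t (i # u @ v)"
    if "u \<in> multi_indices j J" "i \<in> J" "v \<in> multi_indices l J" for u i v
  proof -
    have "i # u @ v \<in> multi_indices (Suc (j + l)) J"
      using that by (auto simp: multi_indices_def)
    moreover have "mset (u @ i # v) = mset (i # u @ v)"
      by simp
    ultimately show ?thesis
      using assms unfolding symmetric_tensor_iff_mset by blast
  qed
  have "mixed_form j (Suc l) J t y z
      = (\<Sum>u \<in> multi_indices j J. \<Sum>i \<in> J. \<Sum>v \<in> multi_indices l J.
           z i * (t (i # u @ v) * (prod_list (map y u) * prod_list (map z v))))"
    unfolding mixed_form_def sum_multi_indices_Suc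
    by (intro sum.cong refl) (simp add: move mult_ac)
  also have "\<dots> = (\<Sum>i \<in> J. z i * mixed_form j l J (\<lambda>ix. t (i # ix)) y z)"
    unfolding mixed_form_def sum_distrib_left
    by (subst sum.swap) simp
  finally show ?thesis .
qed

text \<open>
  The induction fixes the first index: expanding \<open>y i + z i\<close> adds one argument to either group,
  where symmetry moves the new \<open>z\<close> argument past the \<open>y\<close> arguments, and Pascal's rule collects
  the terms.
\<close>

lemma symmetric_form_binomial:
  assumes "symmetric_tensor k J t"
  shows "tensor_form k J t (\<lambda>i. y i + z i)
         = (\<Sum>j\<le>k. real (k choose j) * mixed_form j (k - j) J t y z)"
  using assms
proof (induction k arbitrary: t)
  case 0
  then show ?case by (simp add: tensor_form_def mixed_form_def)
next
  case (Suc m)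
  define a where "a j = mixed_form j (Suc m - j) J t y z" for j
  have left: "(\<Sum>i \<in> J. y i * mixed_form j (m - j) J (\<lambda>ix. t (i # ix)) y z) = a (Suc j)" for j
    by (simp add: a_def mixed_form_Suc_left)
  have right: "(\<Sum>i \<in> J. z i * mixed_form j (m - j) J (\<lambda>ix. t (i # ix)) y z) = a j"
    if "j \<le> m" for j
    using that Suc.prems mixed_form_Suc_right[of j "m - j" J t y z]
    by (simp add: a_def Suc_diff_le)
  have "tensor_form (Suc m) J t (\<lambda>i. y i + z i)
      = (\<Sum>i \<in> J. (y i + z i) *
          (\<Sum>j\<le>m. real (m choose j) * mixed_form j (m - j) J (\<lambda>ix. t (i # ix)) y z))"
    unfolding tensor_form_Suc
    by (intro sum.cong refl) (simp add: Suc.IH symmetric_tensor_Cons[OF Suc.prems])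
  also have "\<dots> = (\<Sum>j\<le>m. real (m choose j) *
       ((\<Sum>i \<in> J. y i * mixed_form j (m - j) J (\<lambda>ix. t (i # ix)) y z)
        + (\<Sum>i \<in> J. z i * mixed_form j (m - j) J (\<lambda>ix. t (i # ix)) y z)))"
    unfolding sum_distrib_left sum.distrib[symmetric]
    by (subst sum.swap) (simp add: algebra_simps)
  also have "\<dots> = (\<Sum>j\<le>m. real (m choose j) * (a (Suc j) + a j))"
    by (simp add: left right)
  also have "\<dots> = (\<Sum>j\<le>Suc m. real (Suc m choose j) * a j)"
  proof -
    have "(\<Sum>j\<le>m. real (m choose j) * a j) = (\<Sum>j\<le>Suc m. real (m choose j) * a j)"
      by simp
    also have "\<dots> = a 0 + (\<Sum>j\<le>m. real (m choose Suc j) * a (Suc j))"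
      by (subst sum.atMost_Suc_shift) simp
    finally show ?thesis
      by (subst sum.atMost_Suc_shift) (simp add: algebra_simps sum.distrib)
  qed
  finally show ?case
    by (simp add: a_def)
qed

section \<open>The least H-eigenvalue as a minimum\<close>

text \<open>Euler's identity for homogeneous forms.\<close>

lemma tensor_form_eigenpair:
  assumes "H_eigenpair k J t l x" "k > 0"
  shows "tensor_form k J t x = l * (\<Sum>i \<in> J. x i ^ k)"
proof -
  obtain m where k: "k = Suc m"
    using assms(2) by (cases k) auto
  have "tensor_form k J t x = (\<Sum>i \<in> J. x i * (l * x i ^ m))"
    unfolding k tensor_form_Suc using assms(1)
    by (intro sum.cong refl) (simp add: H_eigenpair_def k tensor_form_def)
  then show ?thesis
    by (simp add: k sum_distrib_left mult_ac)
qed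

lemma sum_even_power_pos_iff:
  fixes x :: "'a \<Rightarrow> real"
  assumes "finite J" "even k" "k > 0"
  shows "(\<Sum>i \<in> J. x i ^ k) > 0 \<longleftrightarrow> (\<exists>i \<in> J. x i \<noteq> 0)"
proof -
  have nonneg: "x i ^ k \<ge> 0" for i
    using assms(2) by (simp add: zero_le_even_power)
  then have "(\<Sum>i \<in> J. x i ^ k) = 0 \<longleftrightarrow> (\<forall>i \<in> J. x i = 0)"
    using assms by (subst sum_nonneg_eq_0_iff) auto
  moreover have "(\<Sum>i \<in> J. x i ^ k) \<ge> 0"
    by (intro sum_nonneg nonneg)
  ultimately show ?thesis
    by force
qed

lemma form_attains_min_on_sphere:
  fixes J :: "'a set"
  assumes "finite J" "J \<noteq> {}" "even k" "k > 0"
  obtains x where "(\<Sum>i \<in> J. x i ^ k) = 1"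
    and "\<And>y. (\<Sum>i \<in> J. y i ^ k) = 1 \<Longrightarrow> tensor_form k J t x \<le> tensor_form k J t y"
proof -
  \<comment> \<open>Vectors are functions on the whole type, so compactness requires fixing the entries
      outside \<open>J\<close>; Tychonoff's theorem then applies.\<close>
  define box :: "('a \<Rightarrow> real) set" where
    "box = Pi\<^sub>E UNIV (\<lambda>i. if i \<in> J then {-1..1} else {0})"
  define sphere where "sphere = box \<inter> {y. (\<Sum>i \<in> J. y i ^ k) = 1}"
  have "compactin (product_topology (\<lambda>i::'a. euclidean :: real topology) UNIV) box"
    unfolding box_def by (subst compactin_PiE) auto
  then have "compact box"
    by (simp add: euclidean_product_topology)
  moreover have "closed {y :: 'a \<Rightarrow> real. (\<Sum>i \<in> J. y i ^ k) = 1}"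
    by (intro closed_Collect_eq continuous_intros continuous_on_product_coordinates)
  ultimately have "compact sphere"
    unfolding sphere_def by (rule compact_Int_closed)
  moreover have "continuous_on sphere (tensor_form k J t)"
  proof -
    have "continuous_on sphere (\<lambda>y. prod_list (map y ix))" for ix :: "'a list"
      by (induction ix)
         (auto intro!: continuous_intros continuous_on_subset[OF continuous_on_product_coordinates])
    then show ?thesis
      unfolding tensor_form_def by (intro continuous_intros)
  qed
  moreover have in_sphere: "(\<lambda>i. if i \<in> J then y i else 0) \<in> sphere"
    if "(\<Sum>i \<in> J. y i ^ k) = 1" for y
  proof -
    have "\<bar>y i\<bar> \<le> 1" if "i \<in> J" for i
    proof -
      have "y i ^ k \<le> (\<Sum>i \<in> J. y i ^ k)"
        by (rule member_le_sum) (use that assms in \<open>auto simp: zero_le_even_power\<close>)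
      then have "\<bar>y i\<bar> ^ k \<le> 1 ^ k"
        using \<open>(\<Sum>i \<in> J. y i ^ k) = 1\<close> assms(3) by (simp add: power_even_abs)
      then show ?thesis
        using assms(4) by (meson abs_ge_zero power_mono_iff zero_le_one)
    qed
    then show ?thesis
      using that by (force simp: sphere_def box_def abs_le_iff)
  qed
  moreover have "sphere \<noteq> {}"
  proof -
    obtain i where "i \<in> J"
      using assms(2) by blast
    then have "(\<Sum>h \<in> J. of_bool (h = i) ^ k :: real) = 1"
      using assms by (simp add: of_bool_def power_0_left if_distrib[of "\<lambda>c. c ^ k"] cong: if_cong)
    from in_sphere[OF this] show ?thesis
      by blast
  qed
  ultimately obtain x where x: "x \<in> sphere"
    and min: "\<And>y. y \<in> sphere \<Longrightarrow> tensor_form k J t x \<le> tensor_form k J t y"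
    using continuous_attains_inf[of sphere "tensor_form k J t"] by blast
  show thesis
  proof
    show "(\<Sum>i \<in> J. x i ^ k) = 1"
      using x by (simp add: sphere_def)
    fix y :: "'a \<Rightarrow> real" assume "(\<Sum>i \<in> J. y i ^ k) = 1"
    from min[OF in_sphere[OF this]] show "tensor_form k J t x \<le> tensor_form k J t y"
      using tensor_form_cong[of J "\<lambda>i. if i \<in> J then y i else 0" y k t] by simp
  qed
qed

text \<open>Homogeneity extends a bound on the sphere to all vectors.\<close>

lemma form_bound_from_sphere:
  assumes "finite J" "even k" "k > 0"
    and sphere: "\<And>y. (\<Sum>i \<in> J. y i ^ k) = 1 \<Longrightarrow> m \<le> tensor_form k J t y"
  shows "m * (\<Sum>i \<in> J. y i ^ k) \<le> tensor_form k J t y"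
proof (cases "\<exists>i \<in> J. y i \<noteq> 0")
  case True
  define s where "s = (\<Sum>i \<in> J. y i ^ k)"
  have "s > 0"
    using True assms sum_even_power_pos_iff unfolding s_def by blast
  define c where "c = root k (1 / s)"
  have ck: "c ^ k = 1 / s"
    using \<open>s > 0\<close> assms(3) by (simp add: c_def)
  have "(\<Sum>i \<in> J. (c * y i) ^ k) = c ^ k * s"
    by (simp add: s_def power_mult_distrib sum_distrib_left)
  then have "m \<le> tensor_form k J t (\<lambda>i. c * y i)"
    using \<open>s > 0\<close> ck by (intro sphere) simp
  then show ?thesis
    using \<open>s > 0\<close> by (simp add: tensor_form_scale ck s_def[symmetric] field_simps)
next
  case False
  then have "tensor_form k J t y = tensor_form k J t (\<lambda>i. 0 * y i)"
    by (intro tensor_form_cong) simp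
  also have "\<dots> = 0"
    using assms(3) by (simp only: tensor_form_scale) simp
  finally show ?thesis
    using False assms(3) by (simp add: power_0_left)
qed

text \<open>
  Along a coordinate direction the form is a polynomial whose linear coefficient is, by the binomial
  theorem, \<open>k\<close> times the right-hand side of the eigenvalue equation.
\<close>

lemma tensor_form_coordinate_derivative:
  assumes "finite J" "symmetric_tensor k J t" "k > 0" "i \<in> J"
  shows "((\<lambda>e. tensor_form k J t (\<lambda>j. e * of_bool (j = i) + x j)) has_real_derivative
           real k * (\<Sum>ix \<in> multi_indices (k - 1) J. t (i # ix) * prod_list (map x ix))) (at 0)"
proof -
  define c where "c j = real (k choose j) * mixed_form j (k - j) J t (\<lambda>j. of_bool (j = i)) x" for j
  have expand: "tensor_form k J t (\<lambda>j. e * of_bool (j = i) + x j) = (\<Sum>j\<le>k. c j * e ^ j)" for e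
    by (simp add: symmetric_form_binomial[OF assms(2)] mixed_form_scale_left c_def mult_ac)
  have "((\<lambda>e. \<Sum>j\<le>k. c j * e ^ j) has_real_derivative
          (\<Sum>j\<le>k. c j * (real j * 0 ^ (j - 1)))) (at 0)"
    by (auto intro!: derivative_eq_intros sum.cong)
  \<comment> \<open>The term \<open>j = 0\<close> also has the factor \<open>0 ^ 0 = 1\<close>, but is cancelled by \<open>real j\<close>.\<close>
  also have "(\<Sum>j\<le>k. c j * (real j * 0 ^ (j - 1))) = (\<Sum>j\<le>k. if j = 1 then c j else 0)"
    by (intro sum.cong refl) (auto simp: power_0_left)
  also have "\<dots> = c 1"
    using assms(3) by simp
  also have "c 1 = real k *
      (\<Sum>v \<in> multi_indices (k - 1) J. \<Sum>u \<in> multi_indices 1 J.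
        (t (u @ v) * prod_list (map x v)) * prod_list (map (\<lambda>j. of_bool (j = i)) u))"
    unfolding c_def mixed_form_def by (subst sum.swap) (simp add: mult_ac)
  also have "\<dots> = real k * (\<Sum>v \<in> multi_indices (k - 1) J. t (i # v) * prod_list (map x v))"
    by (simp only: sum_multi_indices_unit_vector[OF assms(1,4)]) simp
  finally show ?thesis
    unfolding expand .
qed

lemma form_minimizer_is_eigenvector:
  assumes "finite J" "symmetric_tensor k J t" "k > 0"
    and bound: "\<And>y. m * (\<Sum>i \<in> J. y i ^ k) \<le> tensor_form k J t y"
    and attained: "tensor_form k J t x = m * (\<Sum>i \<in> J. x i ^ k)"
    and nonzero: "\<exists>i \<in> J. x i \<noteq> 0"
  shows "H_eigenpair k J t m x"
proof -
  have "m * x i ^ (k - 1) = (\<Sum>ix \<in> multi_indices (k - 1) J. t (i # ix) * prod_list (map x ix))"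
    (is "_ = ?D") if "i \<in> J" for i
  proof -
    define g where "g e = tensor_form k J t (\<lambda>j. e * of_bool (j = i) + x j)
                          - m * (\<Sum>j \<in> J. (e * of_bool (j = i) + x j) ^ k)" for e
    have "((\<lambda>e. \<Sum>j \<in> J. (e * of_bool (j = i) + x j) ^ k) has_real_derivative
            (\<Sum>j \<in> J. real k * x j ^ (k - 1) * of_bool (j = i))) (at 0)"
      by (auto intro!: derivative_eq_intros sum.cong)
    also have "(\<Sum>j \<in> J. real k * x j ^ (k - 1) * of_bool (j = i)) = real k * x i ^ (k - 1)"
      using that assms(1) by (simp add: of_bool_def if_distrib cong: if_cong)
    finally have "(g has_real_derivative real k * ?D - m * (real k * x i ^ (k - 1))) (at 0)"
      unfolding g_def
      by (intro DERIV_diff DERIV_cmult tensor_form_coordinate_derivative assms that)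
    \<comment> \<open>\<open>g\<close> is nonnegative by the bound and vanishes at \<open>0\<close>.\<close>
    moreover have "\<forall>e. \<bar>0 - e\<bar> < 1 \<longrightarrow> g 0 \<le> g e"
      using bound[of "\<lambda>j. _ * of_bool (j = i) + x j"] attained by (simp add: g_def)
    ultimately have "real k * ?D - m * (real k * x i ^ (k - 1)) = 0"
      using DERIV_local_min zero_less_one by blast
    then show ?thesis
      using assms(3) by (simp add: mult.left_commute)
  qed
  then show ?thesis
    using nonzero by (simp add: H_eigenpair_def)
qed

text \<open>
  The minimum on the sphere is an eigenvalue, and no eigenvalue is smaller, since an eigenvector
  attains its eigenvalue times the sum of \<open>k\<close>-th powers.  So \<open>lambda_min\<close> is this minimum.
\<close>

lemma lambda_min_variational:
  assumes "finite J" "J \<noteq> {}" "even k" "k > 0" "symmetric_tensor k J t"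
  shows "H_eigenvalue k J t (lambda_min k J t)
       \<and> (\<forall>y. lambda_min k J t * (\<Sum>i \<in> J. y i ^ k) \<le> tensor_form k J t y)"
proof -
  obtain x where x: "(\<Sum>i \<in> J. x i ^ k) = 1"
    and min: "\<And>y. (\<Sum>i \<in> J. y i ^ k) = 1 \<Longrightarrow> tensor_form k J t x \<le> tensor_form k J t y"
    using form_attains_min_on_sphere[OF assms(1-4)] by metis
  define m where "m = tensor_form k J t x"
  have bound: "m * (\<Sum>i \<in> J. y i ^ k) \<le> tensor_form k J t y" for y
    using assms min unfolding m_def by (intro form_bound_from_sphere) auto
  have "\<exists>i \<in> J. x i \<noteq> 0"
    using x sum_even_power_pos_iff[OF assms(1,3,4), of x] by simp
  then have "H_eigenpair k J t m x"
    using assms bound x by (intro form_minimizer_is_eigenvector) (auto simp: m_def)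
  then have eig: "H_eigenvalue k J t m"
    unfolding H_eigenvalue_def by blast
  moreover have "m \<le> l" if l: "H_eigenvalue k J t l" for l
  proof -
    obtain z where z: "H_eigenpair k J t l z"
      using l unfolding H_eigenvalue_def by blast
    then have "(\<Sum>i \<in> J. z i ^ k) > 0"
      using sum_even_power_pos_iff[OF assms(1,3,4)] unfolding H_eigenpair_def by blast
    moreover have "m * (\<Sum>i \<in> J. z i ^ k) \<le> l * (\<Sum>i \<in> J. z i ^ k)"
      using bound[of z] tensor_form_eigenpair[OF z assms(4)] by simp
    ultimately show ?thesis
      by simp
  qed
  ultimately have "lambda_min k J t = m"
    unfolding lambda_min_def by (rule Least_equality)
  then show ?thesis
    using eig bound by simp
qed

lemmas lambda_min_is_eigenvalue = lambda_min_variational[THEN conjunct1]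
lemmas lambda_min_le_form = lambda_min_variational[THEN conjunct2, rule_format]

section \<open>Principal subtensors\<close>

lemma lambda_min_principal_subtensor:
  assumes "k > 0"
  shows "lambda_min k I (principal_subtensor k t I) = lambda_min k I t"
proof -
  have "principal_subtensor k t I (i # ix) = t (i # ix)"
    if "i \<in> I" "ix \<in> multi_indices (k - 1) I" for i ix
  proof -
    have "i # ix \<in> multi_indices k I"
      using that assms by (auto simp: multi_indices_def)
    then show ?thesis
      by (simp add: principal_subtensor_def)
  qed
  then have "H_eigenpair k I (principal_subtensor k t I) l x = H_eigenpair k I t l x" for l x
    unfolding H_eigenpair_def by simp
  then show ?thesis
    by (simp add: lambda_min_def H_eigenvalue_def)
qed

text \<open>A least eigenvector of the subtensor, extended by zero, is a test vector for the whole form.\<close>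

lemma lambda_min_antimono:
  assumes "finite J" "I \<noteq> {}" "I \<subseteq> J" "even k" "k > 0" "symmetric_tensor k J t"
  shows "lambda_min k J t \<le> lambda_min k I t"
proof -
  have "finite I" and symI: "symmetric_tensor k I t"
    using assms symmetric_tensor_subset[OF assms(6,3)] by (auto intro: finite_subset)
  then obtain z where z: "H_eigenpair k I t (lambda_min k I t) z"
    using lambda_min_is_eigenvalue assms unfolding H_eigenvalue_def by blast
  define w where "w i = (if i \<in> I then z i else 0)" for i
  have "(\<Sum>i \<in> J. w i ^ k) = (\<Sum>i \<in> I. z i ^ k)"
    using assms by (intro sum.mono_neutral_cong_right) (auto simp: w_def)
  moreover have "tensor_form k J t w = lambda_min k I t * (\<Sum>i \<in> I. z i ^ k)"
    using tensor_form_restrict_support[OF assms(1,3), of k t z] tensor_form_eigenpair[OF z assms(5)]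
    by (simp add: w_def[abs_def])
  ultimately have "lambda_min k J t * (\<Sum>i \<in> I. z i ^ k) \<le> lambda_min k I t * (\<Sum>i \<in> I. z i ^ k)"
    using lambda_min_le_form[of J k t w] assms by auto
  moreover have "(\<Sum>i \<in> I. z i ^ k) > 0"
    using z \<open>finite I\<close> assms sum_even_power_pos_iff unfolding H_eigenpair_def by blast
  ultimately show ?thesis
    by simp
qed

lemma lambda_min_nonpos_of_zero_diagonal:
  assumes "finite J" "J \<noteq> {}" "even k" "k > 0" "symmetric_tensor k J t" "zero_diagonal k J t"
  shows "lambda_min k J t \<le> 0"
proof -
  obtain i where i: "i \<in> J"
    using assms(2) by blast
  have "(\<Sum>h \<in> J. of_bool (h = i) ^ k :: real) = 1"
    using assms i by (simp add: of_bool_def power_0_left if_distrib[of "\<lambda>c. c ^ k"] cong: if_cong)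
  moreover have "tensor_form k J t (\<lambda>h. of_bool (h = i)) = 0"
    using assms i sum_multi_indices_unit_vector[OF assms(1) i, of t k]
    by (simp add: tensor_form_def zero_diagonal_def)
  ultimately show ?thesis
    using lambda_min_le_form[OF assms(1-5), of "\<lambda>h. of_bool (h = i)"] by simp
qed

text \<open>
  Inclusion-exclusion over the positions filled from outside \<open>I\<close>: this is the binomial theorem for
  \<open>x\<close> plus the vector that cancels \<open>x\<close> outside \<open>I\<close>.
\<close>

lemma tensor_form_inclusion_exclusion:
  assumes "finite J" "I \<subseteq> J" "symmetric_tensor k J t"
  shows "tensor_form k I t x
       = (\<Sum>j\<le>k. (-1) ^ j * real (k choose j) *
            (\<Sum>u \<in> multi_indices j (J - I). \<Sum>v \<in> multi_indices (k - j) J.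
               t (u @ v) * prod_list (map x (u @ v))))"
proof -
  define y where "y i = (if i \<in> I then 0 else x i)" for i
  have mixed: "mixed_form j l J t y x
      = (\<Sum>u \<in> multi_indices j (J - I). \<Sum>v \<in> multi_indices l J.
           t (u @ v) * prod_list (map x (u @ v)))" for j l
    unfolding mixed_form_def
  proof (rule sum.mono_neutral_cong_right)
    have "prod_list (map y u) = 0" if "u \<in> multi_indices j J - multi_indices j (J - I)" for u
      by (rule prod_list_eq_0_outside[OF _ that]) (auto simp: y_def)
    then show "\<forall>u \<in> multi_indices j J - multi_indices j (J - I).
        (\<Sum>v \<in> multi_indices l J. t (u @ v) * (prod_list (map y u) * prod_list (map x v))) = 0"
      by simp
  next
    fix u assume "u \<in> multi_indices j (J - I)"
    then have "map y u = map x u"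
      by (auto simp: multi_indices_def y_def)
    then show "(\<Sum>v \<in> multi_indices l J. t (u @ v) * (prod_list (map y u) * prod_list (map x v)))
        = (\<Sum>v \<in> multi_indices l J. t (u @ v) * prod_list (map x (u @ v)))"
      by (simp only: map_append prod_list.append)
  qed (use assms in \<open>auto simp: multi_indices_mono\<close>)
  have "tensor_form k I t x = tensor_form k J t (\<lambda>i. if i \<in> I then x i else 0)"
    by (simp add: tensor_form_restrict_support assms)
  also have "\<dots> = tensor_form k J t (\<lambda>i. - 1 * y i + x i)"
    by (rule tensor_form_cong) (simp add: y_def)
  also have "\<dots> = (\<Sum>j\<le>k. (-1) ^ j * real (k choose j) * mixed_form j (k - j) J t y x)"
    unfolding symmetric_form_binomial[OF assms(3)] mixed_form_scale_left by (simp add: mult_ac)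
  finally show ?thesis
    by (simp add: mixed)
qed

text \<open>
  For an eigenvector, the eigenvalue equation evaluates the terms of degree zero and one.
\<close>

lemma tensor_form_restricted_eigenvector:
  assumes "finite J" "I \<subseteq> J" "symmetric_tensor k J t" "k > 0" "H_eigenpair k J t l x"
  shows "tensor_form k I t x
       = l * ((\<Sum>i \<in> J. x i ^ k) - real k * (\<Sum>i \<in> J - I. x i ^ k))
         - (\<Sum>j = 1..k - 1. (-1) ^ j * real (k choose (j + 1)) *
              (\<Sum>u \<in> multi_indices (j + 1) (J - I). \<Sum>v \<in> multi_indices (k - (j + 1)) J.
                 t (u @ v) * prod_list (map x (u @ v))))"
proof -
  obtain m where k: "k = Suc m"
    using assms(4) by (cases k) auto
  define S where "S j = (\<Sum>u \<in> multi_indices j (J - I). \<Sum>v \<in> multi_indices (k - j) J.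
                           t (u @ v) * prod_list (map x (u @ v)))" for j
  have S0: "S 0 = l * (\<Sum>i \<in> J. x i ^ k)"
    using tensor_form_eigenpair[OF assms(5,4)] by (simp add: S_def tensor_form_def)
  have "S 1 = (\<Sum>i \<in> J - I. x i *
                (\<Sum>v \<in> multi_indices (k - 1) J. t (i # v) * prod_list (map x v)))"
    by (simp add: S_def sum_multi_indices_Suc sum_distrib_left mult_ac)
  also have "\<dots> = (\<Sum>i \<in> J - I. x i * (l * x i ^ (k - 1)))"
    using assms(5) by (intro sum.cong refl) (simp add: H_eigenpair_def)
  also have "\<dots> = l * (\<Sum>i \<in> J - I. x i ^ k)"
    by (simp add: k sum_distrib_left mult_ac)
  finally have S1: "S 1 = l * (\<Sum>i \<in> J - I. x i ^ k)" .
  have "tensor_form k I t x = (\<Sum>j\<le>Suc m. (-1) ^ j * real (k choose j) * S j)"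
    using tensor_form_inclusion_exclusion[OF assms(1-3), of x] by (simp add: S_def k)
  also have "\<dots> = S 0 - (\<Sum>j\<le>m. (-1) ^ j * real (k choose (j + 1)) * S (j + 1))"
    by (subst sum.atMost_Suc_shift) (simp add: sum_negf)
  also have "(\<Sum>j\<le>m. (-1) ^ j * real (k choose (j + 1)) * S (j + 1))
      = real k * S 1 + (\<Sum>j = 1..m. (-1) ^ j * real (k choose (j + 1)) * S (j + 1))"
    by (simp add: atMost_atLeast0 sum.atLeast_Suc_atMost)
  finally have "tensor_form k I t x = l * ((\<Sum>i \<in> J. x i ^ k) - real k * (\<Sum>i \<in> J - I. x i ^ k))
      - (\<Sum>j = 1..k - 1. (-1) ^ j * real (k choose (j + 1)) * S (j + 1))"
    unfolding S0 S1 by (simp add: k algebra_simps)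
  then show ?thesis
    unfolding S_def .
qed

section \<open>Eigenvalue bounds for the principal subtensor\<close>

theorem theorem5p1:
  fixes n k :: nat and t :: "nat list \<Rightarrow> real" and x :: "nat \<Rightarrow> real" and I :: "nat set"
  assumes "n \<ge> 2" and "k \<ge> 2" and "even k"
    and "symmetric_tensor k {1..n} t"
    and "zero_diagonal k {1..n} t"
    and "least_eigenvector k {1..n} t x"
    and "I \<noteq> {}" and "I \<subset> {1..n}"
  shows "let lam = lambda_min k {1..n} t;
             lamI = lambda_min k I (principal_subtensor k t I);
             B = lam * (1 - real k * (\<Sum>i \<in> {1..n} - I. x i ^ k))
                 - (\<Sum>j = 1..k - 1. (-1) ^ j * real (k choose (j + 1)) *
                      (\<Sum>u \<in> multi_indices (j + 1) ({1..n} - I).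
                         \<Sum>v \<in> multi_indices (k - (j + 1)) {1..n}.
                           t (u @ v) * prod_list (map x (u @ v))))
         in lam \<le> lamI \<and> lamI \<le> B \<and>
            ((\<Sum>i \<in> I. x i ^ k) \<noteq> 0 \<longrightarrow> lamI \<le> B / (\<Sum>i \<in> I. x i ^ k))"
proof -
  define J where "J = {1..n}"
  define s where "s = (\<Sum>i \<in> I. x i ^ k)"
  define lam where "lam = lambda_min k J t"
  define lamI where "lamI = lambda_min k I (principal_subtensor k t I)"
  define B where "B = lam * (1 - real k * (\<Sum>i \<in> J - I. x i ^ k))
                 - (\<Sum>j = 1..k - 1. (-1) ^ j * real (k choose (j + 1)) *
                      (\<Sum>u \<in> multi_indices (j + 1) (J - I).
                         \<Sum>v \<in> multi_indices (k - (j + 1)) J.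
                           t (u @ v) * prod_list (map x (u @ v))))"
  have J: "finite J" "I \<subseteq> J" and k: "k > 0"
    using assms by (auto simp: J_def)
  have symJ: "symmetric_tensor k J t" and diagJ: "zero_diagonal k J t"
    using assms by (auto simp: J_def)
  have I: "finite I" and symI: "symmetric_tensor k I t" and diagI: "zero_diagonal k I t"
    using J diagJ symmetric_tensor_subset[OF symJ J(2)]
    by (auto simp: zero_diagonal_def intro: finite_subset)
  have lamI: "lamI = lambda_min k I t"
    using k by (simp add: lamI_def lambda_min_principal_subtensor)
  have eig: "H_eigenpair k J t lam x" and unit: "(\<Sum>i \<in> J. x i ^ k) = 1"
    using assms by (auto simp: least_eigenvector_def unit_vector_def power_even_abs J_def lam_def)
  have nonneg: "x i ^ k \<ge> 0" for i
    using assms(3) by (simp add: zero_le_even_power)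
  have "s \<ge> 0"
    unfolding s_def by (intro sum_nonneg nonneg)
  have "s \<le> 1"
    unfolding s_def unit[symmetric] by (intro sum_mono2 J nonneg)
  have "lam \<le> lamI"
    using lambda_min_antimono[OF J(1) assms(7) J(2) assms(3) k symJ] by (simp add: lam_def lamI)
  have "tensor_form k I t x = B"
    using tensor_form_restricted_eigenvector[OF J symJ k eig] unfolding unit B_def .
  then have test: "lamI * s \<le> B"
    using lambda_min_le_form[OF I assms(7,3) k symI, of x] by (simp add: lamI s_def)
  have "lamI \<le> 0"
    using lambda_min_nonpos_of_zero_diagonal[OF I assms(7,3) k symI diagI] by (simp add: lamI)
  then have "lamI \<le> lamI * s"
    using \<open>s \<le> 1\<close> mult_left_mono_neg[of s 1 lamI] by simp
  then have "lamI \<le> B"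
    using test by simp
  moreover have "s \<noteq> 0 \<longrightarrow> lamI \<le> B / s"
    using test \<open>s \<ge> 0\<close> by (simp add: pos_le_divide_eq)
  ultimately have "lam \<le> lamI \<and> lamI \<le> B \<and> (s \<noteq> 0 \<longrightarrow> lamI \<le> B / s)"
    using \<open>lam \<le> lamI\<close> by simp
  then show ?thesis
    unfolding Let_def lam_def lamI_def B_def s_def J_def .
qed

end
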